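(* Let $m,n\ge 1$, $p_1,\dots,p_m\in S_n(1)$, $C_1,\dots,C_m\in\mathbb{R}_+^{n\times n}$, weights $w_l\ge 0$ with $\sum_{l=1}^m w_l=1$, and $\gamma>0$. For every given $\varepsilon'>0$, the Dual Iterative Bregman Projection algorithm (described in the context) stops after a number of iterations $N$ satisfying $$N\le 4+\frac{44R_v}{\varepsilon'}=O\left(\frac{\max_l\|C_l\|_\infty}{\gamma\varepsilon'}\right),\qquad R_v:=\max_l\frac{\|C_l\|_\infty}{\gamma}+\sum_{k=1}^m w_k\frac{\|C_k\|_\infty}{\gamma}.$$ It returns matrices $B_1,\dots,B_m$ such that $$\sum_{l=1}^m w_l\left\|B_l^T\mathbf 1-\bar q\right\|_1\le\varepsilon',\qquad \bar q=\sum_{l=1}^m w_lB_l^T\mathbf 1,$$ and $$\sum_{l=1}^m w_l\bigl(\langle C_l,B_l\rangle+\gamma H(B_l)\bigr)-\sum_{l=1}^m w_l\bigl(\langle C_l,\pi^*_{\gamma,l}\rangle+\gamma H(\pi^*_{\gamma,l})\bigr)\le\max_l\|C_l\|_\infty\,\varepsilon',$$ where $[\pi^*_{\gamma,1},\dots,\pi^*_{\gamma,m}]$ is a solution of the regularized barycenter problem $$\min\ \sum_{l=1}^m w_l\bigl\{\langle\pi_l,C_l\rangle+\gamma H(\pi_l)\bigr\}\quad\text{over }\pi_l\in\mathbb{R}_+^{n\times n},\ \pi_l\mathbf 1=p_l\ (l=1,\dots,m),\ \pi_1^T\mathbf 1=\dots=\pi_m^T\mathbf 1 .$$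
   Context: $S_n(1)=\{q\in\mathbb{R}_+^n:\sum_i q_i=1\}$; $\mathbf 1$ is the all-ones column vector; $\langle A,B\rangle=\sum_{i,j}A_{ij}B_{ij}$; $\|C\|_\infty$ is the maximal element of the nonnegative matrix $C$; $H(\pi)=\sum_{i,j}\pi_{ij}(\ln\pi_{ij}-1)$. Logarithms and exponentials of vectors and matrices are element-wise. Conventions when some $p_l$ has zero entries: $0\ln0=0$, $\ln0=-\infty$, $e^{-\infty}=0$. Let $K_l=\exp(-C_l/\gamma)$ (element-wise) and $B_l(u_l,v_l)=\mathrm{diag}(e^{u_l})K_l\,\mathrm{diag}(e^{v_l})$. Dual Iterative Bregman Projection algorithm: start with $t=0$ and $u_l^0=v_l^0=0\in\mathbb{R}^n$ for $l=1,\dots,m$. Repeat: (i) for all $l$, $v_l^{t+1}:=\sum_{k=1}^m w_k\ln(K_k^Te^{u_k^t})-\ln(K_l^Te^{u_l^t})$ and $u_l^{t+1}:=u_l^t$; then $t:=t+1$; (ii) for all $l$, $u_l^{t+1}:=\ln p_l-\ln(K_le^{v_l^t})$ and $v_l^{t+1}:=v_l^t$; then $t:=t+1$; until $\sum_{l=1}^m w_l\|B_l^T(u_l^t,v_l^t)\mathbf 1-\bar q^t\|_1\le\varepsilon'$, where $\bar q^t:=\sum_{l=1}^m w_lB_l^T(u_l^t,v_l^t)\mathbf 1$. Output $B_l=B_l(u_l^t,v_l^t)$, $l=1,\dots,m$. The number of iterations $N$ is the value of the counter $t$ when the algorithm stops (each of the half-steps (i) and (ii) counts as one iteration). *)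

theory Defs
  imports Complex_Main "HOL-Library.Extended_Real" "HOL-Library.Landau_Symbols"
begin

text \<open>
  Vectors of length \<open>n\<close> and \<open>n \<times> n\<close> matrices are functions on \<open>nat\<close> of which only the entries
  with indices below \<open>n\<close> are used; families \<open>p, C, w, u, v, B\<close> take the index \<open>l < m\<close> first.
  The dimensions are not types because the asymptotic bound is uniform in them.
\<close>

definition prob_simplex :: "nat \<Rightarrow> (nat \<Rightarrow> real) set" where
  "prob_simplex n = {q. (\<forall>i<n. 0 \<le> q i) \<and> (\<Sum>i<n. q i) = 1}"

definition mat_vec :: "nat \<Rightarrow> (nat \<Rightarrow> nat \<Rightarrow> real) \<Rightarrow> (nat \<Rightarrow> real) \<Rightarrow> nat \<Rightarrow> real" where
  "mat_vec n A x = (\<lambda>i. \<Sum>j<n. A i j * x j)"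

definition mat_transpose :: "(nat \<Rightarrow> nat \<Rightarrow> real) \<Rightarrow> nat \<Rightarrow> nat \<Rightarrow> real" where
  "mat_transpose A = (\<lambda>i j. A j i)"

definition ones :: "nat \<Rightarrow> real" where
  "ones = (\<lambda>_. 1)"

definition frob :: "nat \<Rightarrow> (nat \<Rightarrow> nat \<Rightarrow> real) \<Rightarrow> (nat \<Rightarrow> nat \<Rightarrow> real) \<Rightarrow> real" where
  "frob n A B = (\<Sum>i<n. \<Sum>j<n. A i j * B i j)"

definition l1_norm :: "nat \<Rightarrow> (nat \<Rightarrow> real) \<Rightarrow> real" where
  "l1_norm n x = (\<Sum>i<n. \<bar>x i\<bar>)"

definition max_entry :: "nat \<Rightarrow> (nat \<Rightarrow> nat \<Rightarrow> real) \<Rightarrow> real" where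
  "max_entry n C = (MAX (i, j) \<in> {..<n} \<times> {..<n}. C i j)"

text \<open>The convention \<open>0 ln 0 = 0\<close> holds here because \<open>ln 0\<close> on the reals is a (junk) real number.\<close>

definition entropy :: "nat \<Rightarrow> (nat \<Rightarrow> nat \<Rightarrow> real) \<Rightarrow> real" where
  "entropy n \<pi> = (\<Sum>i<n. \<Sum>j<n. \<pi> i j * (ln (\<pi> i j) - 1))"

text \<open>
  Logarithm of a nonnegative real and exponential of an element of \<open>[-\<infinity>, \<infinity>)\<close>, with
  \<open>ln 0 = -\<infinity>\<close> and \<open>exp (-\<infinity>) = 0\<close>.  The value \<open>\<infinity>\<close> does not occur in the algorithm.
\<close>

definition ln_ext :: "real \<Rightarrow> ereal" where
  "ln_ext x = (if x = 0 then -\<infinity> else ereal (ln x))"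

definition exp_ext :: "ereal \<Rightarrow> real" where
  "exp_ext x = (if x = -\<infinity> then 0 else exp (real_of_ereal x))"

definition kernel :: "real \<Rightarrow> (nat \<Rightarrow> nat \<Rightarrow> real) \<Rightarrow> nat \<Rightarrow> nat \<Rightarrow> real" where
  "kernel \<gamma> C = (\<lambda>i j. exp (- C i j / \<gamma>))"

definition scaled_kernel ::
  "real \<Rightarrow> (nat \<Rightarrow> nat \<Rightarrow> real) \<Rightarrow> (nat \<Rightarrow> ereal) \<Rightarrow> (nat \<Rightarrow> ereal) \<Rightarrow> nat \<Rightarrow> nat \<Rightarrow> real" where
  "scaled_kernel \<gamma> C u v = (\<lambda>i j. exp_ext (u i) * kernel \<gamma> C i j * exp_ext (v j))"

definition v_step ::
  "nat \<Rightarrow> nat \<Rightarrow> (nat \<Rightarrow> nat \<Rightarrow> nat \<Rightarrow> real) \<Rightarrow> (nat \<Rightarrow> real) \<Rightarrow> real \<Rightarrow>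
   (nat \<Rightarrow> nat \<Rightarrow> ereal) \<Rightarrow> nat \<Rightarrow> nat \<Rightarrow> ereal" where
  "v_step m n C w \<gamma> u = (\<lambda>l j.
     (\<Sum>k<m. ereal (w k) * ln_ext (mat_vec n (mat_transpose (kernel \<gamma> (C k))) (\<lambda>i. exp_ext (u k i)) j))
     - ln_ext (mat_vec n (mat_transpose (kernel \<gamma> (C l))) (\<lambda>i. exp_ext (u l i)) j))"

definition u_step ::
  "nat \<Rightarrow> (nat \<Rightarrow> nat \<Rightarrow> real) \<Rightarrow> (nat \<Rightarrow> nat \<Rightarrow> nat \<Rightarrow> real) \<Rightarrow> real \<Rightarrow>
   (nat \<Rightarrow> nat \<Rightarrow> ereal) \<Rightarrow> nat \<Rightarrow> nat \<Rightarrow> ereal" where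
  "u_step n p C \<gamma> v = (\<lambda>l i.
     ln_ext (p l i) - ln_ext (mat_vec n (kernel \<gamma> (C l)) (\<lambda>j. exp_ext (v l j)) i))"

primrec dibp ::
  "nat \<Rightarrow> nat \<Rightarrow> (nat \<Rightarrow> nat \<Rightarrow> real) \<Rightarrow> (nat \<Rightarrow> nat \<Rightarrow> nat \<Rightarrow> real) \<Rightarrow> (nat \<Rightarrow> real) \<Rightarrow> real \<Rightarrow>
   nat \<Rightarrow> (nat \<Rightarrow> nat \<Rightarrow> ereal) \<times> (nat \<Rightarrow> nat \<Rightarrow> ereal)" where
  "dibp m n p C w \<gamma> 0 = ((\<lambda>_ _. 0), (\<lambda>_ _. 0))"
| "dibp m n p C w \<gamma> (Suc t) =
     (case dibp m n p C w \<gamma> t of (u, v) \<Rightarrow>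
        if even t then (u, v_step m n C w \<gamma> u) else (u_step n p C \<gamma> v, v))"

definition dibp_plan ::
  "nat \<Rightarrow> nat \<Rightarrow> (nat \<Rightarrow> nat \<Rightarrow> real) \<Rightarrow> (nat \<Rightarrow> nat \<Rightarrow> nat \<Rightarrow> real) \<Rightarrow> (nat \<Rightarrow> real) \<Rightarrow> real \<Rightarrow>
   nat \<Rightarrow> nat \<Rightarrow> nat \<Rightarrow> nat \<Rightarrow> real" where
  "dibp_plan m n p C w \<gamma> t = (\<lambda>l.
     case dibp m n p C w \<gamma> t of (u, v) \<Rightarrow> scaled_kernel \<gamma> (C l) (u l) (v l))"

definition mean_marginal ::
  "nat \<Rightarrow> nat \<Rightarrow> (nat \<Rightarrow> real) \<Rightarrow> (nat \<Rightarrow> nat \<Rightarrow> nat \<Rightarrow> real) \<Rightarrow> nat \<Rightarrow> real" where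
  "mean_marginal m n w B = (\<lambda>j. \<Sum>l<m. w l * mat_vec n (mat_transpose (B l)) ones j)"

definition marginal_gap ::
  "nat \<Rightarrow> nat \<Rightarrow> (nat \<Rightarrow> real) \<Rightarrow> (nat \<Rightarrow> nat \<Rightarrow> nat \<Rightarrow> real) \<Rightarrow> real" where
  "marginal_gap m n w B =
     (\<Sum>l<m. w l * l1_norm n (\<lambda>j. mat_vec n (mat_transpose (B l)) ones j - mean_marginal m n w B j))"

text \<open>
  The stopping test is evaluated at the end of the loop body only, that is, at the counter
  values \<open>t = 2, 4, 6, \<dots>\<close>.
\<close>

definition dibp_exit ::
  "nat \<Rightarrow> nat \<Rightarrow> (nat \<Rightarrow> nat \<Rightarrow> real) \<Rightarrow> (nat \<Rightarrow> nat \<Rightarrow> nat \<Rightarrow> real) \<Rightarrow> (nat \<Rightarrow> real) \<Rightarrow> real \<Rightarrow>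
   real \<Rightarrow> nat \<Rightarrow> bool" where
  "dibp_exit m n p C w \<gamma> \<epsilon> t \<longleftrightarrow>
     0 < t \<and> even t \<and> marginal_gap m n w (dibp_plan m n p C w \<gamma> t) \<le> \<epsilon>"

definition dibp_stops_after ::
  "nat \<Rightarrow> nat \<Rightarrow> (nat \<Rightarrow> nat \<Rightarrow> real) \<Rightarrow> (nat \<Rightarrow> nat \<Rightarrow> nat \<Rightarrow> real) \<Rightarrow> (nat \<Rightarrow> real) \<Rightarrow> real \<Rightarrow>
   real \<Rightarrow> nat \<Rightarrow> bool" where
  "dibp_stops_after m n p C w \<gamma> \<epsilon> N \<longleftrightarrow>
     dibp_exit m n p C w \<gamma> \<epsilon> N \<and> (\<forall>t<N. \<not> dibp_exit m n p C w \<gamma> \<epsilon> t)"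

definition objective ::
  "nat \<Rightarrow> nat \<Rightarrow> (nat \<Rightarrow> nat \<Rightarrow> nat \<Rightarrow> real) \<Rightarrow> (nat \<Rightarrow> real) \<Rightarrow> real \<Rightarrow>
   (nat \<Rightarrow> nat \<Rightarrow> nat \<Rightarrow> real) \<Rightarrow> real" where
  "objective m n C w \<gamma> \<pi> = (\<Sum>l<m. w l * (frob n (C l) (\<pi> l) + \<gamma> * entropy n (\<pi> l)))"

definition feasible ::
  "nat \<Rightarrow> nat \<Rightarrow> (nat \<Rightarrow> nat \<Rightarrow> real) \<Rightarrow> (nat \<Rightarrow> nat \<Rightarrow> nat \<Rightarrow> real) \<Rightarrow> bool" where
  "feasible m n p \<pi> \<longleftrightarrow>
     (\<forall>l<m. \<forall>i<n. \<forall>j<n. 0 \<le> \<pi> l i j) \<and>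
     (\<forall>l<m. \<forall>i<n. mat_vec n (\<pi> l) ones i = p l i) \<and>
     (\<forall>k<m. \<forall>l<m. \<forall>j<n. mat_vec n (mat_transpose (\<pi> k)) ones j = mat_vec n (mat_transpose (\<pi> l)) ones j)"

definition barycenter_solution ::
  "nat \<Rightarrow> nat \<Rightarrow> (nat \<Rightarrow> nat \<Rightarrow> real) \<Rightarrow> (nat \<Rightarrow> nat \<Rightarrow> nat \<Rightarrow> real) \<Rightarrow> (nat \<Rightarrow> real) \<Rightarrow> real \<Rightarrow>
   (nat \<Rightarrow> nat \<Rightarrow> nat \<Rightarrow> real) \<Rightarrow> bool" where
  "barycenter_solution m n p C w \<gamma> \<pi> \<longleftrightarrow> is_arg_min (objective m n C w \<gamma>) (feasible m n p) \<pi>"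

definition barycenter_data ::
  "nat \<Rightarrow> nat \<Rightarrow> (nat \<Rightarrow> nat \<Rightarrow> real) \<Rightarrow> (nat \<Rightarrow> nat \<Rightarrow> nat \<Rightarrow> real) \<Rightarrow> (nat \<Rightarrow> real) \<Rightarrow> real \<Rightarrow>
   bool" where
  "barycenter_data m n p C w \<gamma> \<longleftrightarrow>
     1 \<le> m \<and> 1 \<le> n \<and> (\<forall>l<m. p l \<in> prob_simplex n) \<and> (\<forall>l<m. \<forall>i<n. \<forall>j<n. 0 \<le> C l i j) \<and>
     (\<forall>l<m. 0 \<le> w l) \<and> (\<Sum>l<m. w l) = 1 \<and> 0 < \<gamma>"

definition R_v ::
  "nat \<Rightarrow> nat \<Rightarrow> (nat \<Rightarrow> nat \<Rightarrow> nat \<Rightarrow> real) \<Rightarrow> (nat \<Rightarrow> real) \<Rightarrow> real \<Rightarrow> real" where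
  "R_v m n C w \<gamma> =
     (MAX l\<in>{..<m}. max_entry n (C l) / \<gamma>) + (\<Sum>k<m. w k * (max_entry n (C k) / \<gamma>))"

definition cost_ratio ::
  "nat \<Rightarrow> nat \<Rightarrow> (nat \<Rightarrow> nat \<Rightarrow> nat \<Rightarrow> real) \<Rightarrow> real \<Rightarrow> real \<Rightarrow> real" where
  "cost_ratio m n C \<gamma> \<epsilon> = (MAX l\<in>{..<m}. max_entry n (C l)) / (\<gamma> * \<epsilon>)"

text \<open>
  The filter on tuples \<open>(m, n, p, C, w, \<gamma>, \<epsilon>)\<close> of admissible data along which
  \<open>cost_ratio m n C \<gamma> \<epsilon>\<close> tends to infinity.  A Landau bound along it has a constant that depends
  on none of the parameters, not even on the dimensions.  Some such regime is implicit in the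
  bound: \<open>4 + 44 R / \<epsilon>\<close> is at least \<open>4\<close>, whereas \<open>cost_ratio\<close> can be arbitrarily small.
\<close>

definition large_cost_ratio ::
  "(nat \<times> nat \<times> (nat \<Rightarrow> nat \<Rightarrow> real) \<times> (nat \<Rightarrow> nat \<Rightarrow> nat \<Rightarrow> real) \<times> (nat \<Rightarrow> real) \<times> real \<times> real)
   filter" where
  "large_cost_ratio =
     inf (filtercomap (\<lambda>(m, n, p, C, w, \<gamma>, \<epsilon>). cost_ratio m n C \<gamma> \<epsilon>) at_top)
         (principal {(m, n, p, C, w, \<gamma>, \<epsilon>). barycenter_data m n p C w \<gamma> \<and> 0 < \<epsilon>})"

end

theory Submission
  imports Defs "HOL-Analysis.Convex"
begin

text \<open>
  A \<open>u\<close>-step makes the row sums exact, so after it the plans are functions of the vectors \<open>v\<close>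
  alone, and each full round is a step \<open>v \<mapsto> v'\<close> that decreases the convex semidual function
  \<open>F v = \<Sum>\<^sub>l w\<^sub>l \<langle>p\<^sub>l, ln (K\<^sub>l e\<^bsup>v\<^sub>l\<^esup>)\<rangle>\<close>, whose gradient consists of the weighted column
  sums \<open>w\<^sub>l q\<^sub>l\<close>.  Explicitly, \<open>v'\<^sub>l = v\<^sub>l + ln g - ln q\<^sub>l\<close> with \<open>g\<close> the weighted geometric mean
  of the \<open>q\<^sub>l\<close>, and \<open>F v - F v'\<close> is at least the mass \<open>1 - \<Sum>\<^sub>j g\<^sub>j\<close> missing from \<open>g\<close>, which
  dominates \<open>3/16\<close> times the square of the quantity \<open>d\<close> in the stopping test.  Conversely,
  convexity and \<open>\<Sum>\<^sub>l w\<^sub>l v\<^sub>l = 0\<close> bound \<open>F v\<close> minus any later value by \<open>R d\<close>, since the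
  oscillation of each \<open>v\<^sub>l\<close> is at most \<open>R = R_v\<close>; comparing with later iterates makes the
  existence of a dual optimum unnecessary.  The two estimates allow at most \<open>64 R / (3 \<epsilon>)\<close> rounds
  with \<open>d > \<epsilon>\<close>.  The bound on the objective is the same convexity estimate, with a feasible
  family of plans in place of a later iterate.
\<close>

section \<open>Weighted means\<close>

definition geometric_mean :: "'a set \<Rightarrow> ('a \<Rightarrow> real) \<Rightarrow> ('a \<Rightarrow> real) \<Rightarrow> real" where
  "geometric_mean S w x = exp (\<Sum>k\<in>S. w k * ln (x k))"

definition l1_dispersion :: "'a set \<Rightarrow> 'b set \<Rightarrow> ('a \<Rightarrow> real) \<Rightarrow> ('a \<Rightarrow> 'b \<Rightarrow> real) \<Rightarrow> real" where
  "l1_dispersion S T w q = (\<Sum>k\<in>S. w k * (\<Sum>j\<in>T. \<bar>q k j - (\<Sum>l\<in>S. w l * q l j)\<bar>))"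

definition total_variance :: "'a set \<Rightarrow> 'b set \<Rightarrow> ('a \<Rightarrow> real) \<Rightarrow> ('a \<Rightarrow> 'b \<Rightarrow> real) \<Rightarrow> real" where
  "total_variance S T w x = (\<Sum>j\<in>T. \<Sum>k\<in>S. w k * (x k j - (\<Sum>l\<in>S. w l * x l j))\<^sup>2)"

lemma weighted_Cauchy_Schwarz:
  fixes w x y :: "'a \<Rightarrow> real"
  assumes "\<And>k. k \<in> S \<Longrightarrow> 0 \<le> w k"
  shows "(\<Sum>k\<in>S. w k * (x k * y k)) \<le> sqrt (\<Sum>k\<in>S. w k * (x k)\<^sup>2) * sqrt (\<Sum>k\<in>S. w k * (y k)\<^sup>2)"
proof -
  have "(\<Sum>k\<in>S. w k * (x k * y k)) = (\<Sum>k\<in>S. (sqrt (w k) * x k) * (sqrt (w k) * y k))"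
  proof (intro sum.cong refl)
    fix k assume "k \<in> S"
    then have "sqrt (w k) * sqrt (w k) = w k" using assms by simp
    then show "w k * (x k * y k) = (sqrt (w k) * x k) * (sqrt (w k) * y k)"
      by (metis mult.assoc mult.left_commute)
  qed
  also have "\<dots> \<le> sqrt ((\<Sum>k\<in>S. (sqrt (w k) * x k)\<^sup>2) * (\<Sum>k\<in>S. (sqrt (w k) * y k)\<^sup>2))"
    by (intro real_le_rsqrt Cauchy_Schwarz_ineq_sum)
  also have "\<dots> = sqrt ((\<Sum>k\<in>S. w k * (x k)\<^sup>2) * (\<Sum>k\<in>S. w k * (y k)\<^sup>2))"
    using assms by (simp add: power_mult_distrib cong: sum.cong)
  finally show ?thesis by (simp add: real_sqrt_mult)
qed

lemma weighted_variance_eq: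
  fixes w x :: "'a \<Rightarrow> real"
  assumes "(\<Sum>k\<in>S. w k) = 1"
  shows "(\<Sum>k\<in>S. w k * (x k - (\<Sum>k\<in>S. w k * x k))\<^sup>2) = (\<Sum>k\<in>S. w k * (x k)\<^sup>2) - (\<Sum>k\<in>S. w k * x k)\<^sup>2"
proof -
  define \<mu> where "\<mu> = (\<Sum>k\<in>S. w k * x k)"
  have "(\<Sum>k\<in>S. w k * (x k - \<mu>)\<^sup>2) = (\<Sum>k\<in>S. w k * (x k)\<^sup>2 - 2 * \<mu> * (w k * x k) + \<mu>\<^sup>2 * w k)"
    by (simp add: power2_diff algebra_simps)
  also have "\<dots> = (\<Sum>k\<in>S. w k * (x k)\<^sup>2) - \<mu>\<^sup>2"
    by (simp add: sum.distrib sum_subtractf assms power2_eq_square flip: sum_distrib_left \<mu>_def)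
  finally show ?thesis by (simp add: \<mu>_def)
qed

lemma total_variance_sqrt_eq:
  assumes w_sum: "(\<Sum>k\<in>S. w k) = 1"
    and nonneg: "\<And>k j. k \<in> S \<Longrightarrow> j \<in> T \<Longrightarrow> 0 \<le> q k j"
    and mass: "\<And>k. k \<in> S \<Longrightarrow> (\<Sum>j\<in>T. q k j) = 1"
  shows "total_variance S T w (\<lambda>k j. sqrt (q k j)) = 1 - (\<Sum>j\<in>T. (\<Sum>k\<in>S. w k * sqrt (q k j))\<^sup>2)"
proof -
  have "(\<Sum>j\<in>T. \<Sum>k\<in>S. w k * (sqrt (q k j))\<^sup>2) = (\<Sum>j\<in>T. \<Sum>k\<in>S. w k * q k j)"
    by (intro sum.cong) (simp_all add: nonneg)
  also have "\<dots> = 1"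
    by (subst sum.swap) (simp add: mass w_sum flip: sum_distrib_left)
  finally show ?thesis
    by (simp add: total_variance_def weighted_variance_eq w_sum sum_subtractf)
qed

lemma sum_mult_le_oscillation:
  fixes x y :: "'b \<Rightarrow> real"
  assumes "(\<Sum>j\<in>T. x j) = 0" and osc: "\<And>i j. i \<in> T \<Longrightarrow> j \<in> T \<Longrightarrow> y i - y j \<le> 2 * R"
  shows "(\<Sum>j\<in>T. x j * y j) \<le> R * (\<Sum>j\<in>T. \<bar>x j\<bar>)"
proof (cases "finite T \<and> T \<noteq> {}")
  case True
  define z where "z = Min (y ` T) + R"
  have "Min (y ` T) \<in> y ` T" using True by (intro Min_in) auto
  then obtain i where i: "i \<in> T" "y i = Min (y ` T)" by auto
  have close: "\<bar>y j - z\<bar> \<le> R" if "j \<in> T" for j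
  proof -
    have "y i \<le> y j" using i True that by simp
    with osc[OF that i(1)] i(2) show ?thesis by (auto simp: z_def)
  qed
  have "(\<Sum>j\<in>T. x j * y j) = (\<Sum>j\<in>T. x j * (y j - z)) + z * (\<Sum>j\<in>T. x j)"
    by (simp add: sum_distrib_left sum_subtractf algebra_simps)
  also have "\<dots> \<le> (\<Sum>j\<in>T. \<bar>x j\<bar> * R)"
  proof -
    have "x j * (y j - z) \<le> \<bar>x j\<bar> * R" if "j \<in> T" for j
      using abs_ge_self[of "x j * (y j - z)"] mult_left_mono[OF close[OF that], of "\<bar>x j\<bar>"]
      by (simp add: abs_mult)
    then show ?thesis by (simp add: assms(1) sum_mono)
  qed
  finally show ?thesis by (simp add: sum_distrib_left mult.commute)
qed auto

context
  fixes S :: "'a set" and w :: "'a \<Rightarrow> real"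
  assumes w_nonneg: "\<And>k. k \<in> S \<Longrightarrow> 0 \<le> w k" and w_sum: "(\<Sum>k\<in>S. w k) = 1"
begin

lemma weighted_abs_deviation_square_le:
  fixes x :: "'a \<Rightarrow> real"
  defines "\<mu> \<equiv> \<Sum>k\<in>S. w k * x k"
  defines "V \<equiv> \<Sum>k\<in>S. w k * (x k - \<mu>)\<^sup>2"
  shows "(\<Sum>k\<in>S. w k * \<bar>(x k)\<^sup>2 - (\<Sum>k\<in>S. w k * (x k)\<^sup>2)\<bar>) \<le> V + sqrt V * sqrt (V + 4 * \<mu>\<^sup>2)"
proof -
  have mean_square: "(\<Sum>k\<in>S. w k * (x k)\<^sup>2) = \<mu>\<^sup>2 + V"
    by (simp add: V_def \<mu>_def weighted_variance_eq w_sum)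
  have V_nonneg: "0 \<le> V"
    unfolding V_def by (intro sum_nonneg mult_nonneg_nonneg w_nonneg) auto
  have factor: "\<bar>(x k)\<^sup>2 - (\<mu>\<^sup>2 + V)\<bar> \<le> \<bar>x k - \<mu>\<bar> * \<bar>x k + \<mu>\<bar> + V" for k
  proof -
    have "\<bar>(x k)\<^sup>2 - (\<mu>\<^sup>2 + V)\<bar> \<le> \<bar>(x k)\<^sup>2 - \<mu>\<^sup>2\<bar> + V" using V_nonneg by linarith
    also have "(x k)\<^sup>2 - \<mu>\<^sup>2 = (x k - \<mu>) * (x k + \<mu>)" by (simp add: power2_eq_square algebra_simps)
    finally show ?thesis by (simp add: abs_mult)
  qed
  have sum_square: "(\<Sum>k\<in>S. w k * (x k + \<mu>)\<^sup>2) = V + 4 * \<mu>\<^sup>2"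
  proof -
    have "(\<Sum>k\<in>S. w k * (x k + \<mu>)\<^sup>2) = (\<Sum>k\<in>S. w k * (x k - \<mu>)\<^sup>2 + 4 * \<mu> * (w k * x k))"
      by (simp add: power2_eq_square algebra_simps)
    then show ?thesis
      by (simp add: V_def sum.distrib power2_eq_square flip: \<mu>_def sum_distrib_left)
  qed
  have "(\<Sum>k\<in>S. w k * \<bar>(x k)\<^sup>2 - (\<mu>\<^sup>2 + V)\<bar>) \<le> (\<Sum>k\<in>S. w k * (\<bar>x k - \<mu>\<bar> * \<bar>x k + \<mu>\<bar> + V))"
    by (intro sum_mono mult_left_mono factor w_nonneg)
  also have "\<dots> = (\<Sum>k\<in>S. w k * (\<bar>x k - \<mu>\<bar> * \<bar>x k + \<mu>\<bar>)) + V"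
    by (simp add: distrib_left sum.distrib w_sum flip: sum_distrib_right)
  also have "(\<Sum>k\<in>S. w k * (\<bar>x k - \<mu>\<bar> * \<bar>x k + \<mu>\<bar>)) \<le> sqrt V * sqrt (V + 4 * \<mu>\<^sup>2)"
    using weighted_Cauchy_Schwarz[of S w "\<lambda>k. \<bar>x k - \<mu>\<bar>" "\<lambda>k. \<bar>x k + \<mu>\<bar>", OF w_nonneg]
    by (simp add: sum_square flip: V_def)
  finally show ?thesis by (simp add: mean_square)
qed

lemma geometric_mean_le_weighted_sqrt_square:
  assumes pos: "\<And>k. k \<in> S \<Longrightarrow> 0 < x k"
  shows "geometric_mean S w x \<le> (\<Sum>k\<in>S. w k * sqrt (x k))\<^sup>2"
proof -
  have S: "finite S" "S \<noteq> {}" using w_sum by (auto intro: ccontr)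
  have "(\<Sum>k\<in>S. w k * ln (x k)) = 2 * (\<Sum>k\<in>S. w k * ln (sqrt (x k)))"
    unfolding sum_distrib_left by (intro sum.cong) (simp_all add: ln_sqrt pos less_imp_le)
  then have "geometric_mean S w x = (exp (\<Sum>k\<in>S. w k * ln (sqrt (x k))))\<^sup>2"
    by (simp add: geometric_mean_def exp_double)
  also have "\<dots> \<le> (\<Sum>k\<in>S. w k * exp (ln (sqrt (x k))))\<^sup>2"
    using convex_on_sum[OF S exp_convex w_sum w_nonneg, of "\<lambda>k. ln (sqrt (x k))"]
    by (intro power_mono) auto
  also have "(\<Sum>k\<in>S. w k * exp (ln (sqrt (x k)))) = (\<Sum>k\<in>S. w k * sqrt (x k))"
    using pos by (intro sum.cong) auto
  finally show ?thesis .
qed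

lemma l1_dispersion_le_total_variance_sqrt:
  fixes q :: "'a \<Rightarrow> 'b \<Rightarrow> real"
  assumes nonneg: "\<And>k j. k \<in> S \<Longrightarrow> j \<in> T \<Longrightarrow> 0 \<le> q k j"
    and mass: "\<And>k. k \<in> S \<Longrightarrow> (\<Sum>j\<in>T. q k j) = 1"
  defines "V \<equiv> total_variance S T w (\<lambda>k j. sqrt (q k j))"
  shows "l1_dispersion S T w q \<le> V + sqrt V * sqrt (4 - 3 * V)"
proof -
  define \<mu> where "\<mu> j = (\<Sum>k\<in>S. w k * sqrt (q k j))" for j
  define var where "var j = (\<Sum>k\<in>S. w k * (sqrt (q k j) - \<mu> j)\<^sup>2)" for j
  have V_eq_sum: "V = (\<Sum>j\<in>T. var j)" by (simp add: V_def total_variance_def var_def \<mu>_def)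
  have V_eq: "V = 1 - (\<Sum>j\<in>T. (\<mu> j)\<^sup>2)"
    by (simp add: V_def \<mu>_def total_variance_sqrt_eq w_sum nonneg mass)
  have var_nonneg: "0 \<le> var j" for j
    unfolding var_def by (intro sum_nonneg mult_nonneg_nonneg w_nonneg) auto
  have "l1_dispersion S T w q = (\<Sum>j\<in>T. \<Sum>k\<in>S. w k * \<bar>q k j - (\<Sum>l\<in>S. w l * q l j)\<bar>)"
    unfolding l1_dispersion_def sum_distrib_left by (rule sum.swap)
  also have "\<dots> \<le> (\<Sum>j\<in>T. var j + sqrt (var j) * sqrt (var j + 4 * (\<mu> j)\<^sup>2))"
  proof (rule sum_mono)
    fix j assume "j \<in> T"
    then show "(\<Sum>k\<in>S. w k * \<bar>q k j - (\<Sum>l\<in>S. w l * q l j)\<bar>)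
        \<le> var j + sqrt (var j) * sqrt (var j + 4 * (\<mu> j)\<^sup>2)"
      using weighted_abs_deviation_square_le[of "\<lambda>k. sqrt (q k j)"]
      by (simp add: var_def \<mu>_def nonneg)
  qed
  also have "\<dots> = V + (\<Sum>j\<in>T. sqrt (var j) * sqrt (var j + 4 * (\<mu> j)\<^sup>2))"
    by (simp add: V_eq_sum sum.distrib)
  also have "\<dots> \<le> V + sqrt V * sqrt (V + 4 * (\<Sum>j\<in>T. (\<mu> j)\<^sup>2))"
    using weighted_Cauchy_Schwarz[of T "\<lambda>_. 1" "\<lambda>j. sqrt (var j)" "\<lambda>j. sqrt (var j + 4 * (\<mu> j)\<^sup>2)"]
    by (simp add: var_nonneg V_eq_sum sum.distrib sum_distrib_left)
  also have "V + 4 * (\<Sum>j\<in>T. (\<mu> j)\<^sup>2) = 4 - 3 * V" by (simp add: V_eq)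
  finally show ?thesis .
qed

text \<open>
  Both sides are compared with the total variance of the square roots, which for two equal weights
  is half the squared Hellinger distance.
\<close>

lemma square_l1_dispersion_le:
  fixes q :: "'a \<Rightarrow> 'b \<Rightarrow> real"
  assumes pos: "\<And>k j. k \<in> S \<Longrightarrow> j \<in> T \<Longrightarrow> 0 < q k j"
    and mass: "\<And>k. k \<in> S \<Longrightarrow> (\<Sum>j\<in>T. q k j) = 1"
  shows "(l1_dispersion S T w q)\<^sup>2 \<le> 16 / 3 * (1 - (\<Sum>j\<in>T. geometric_mean S w (\<lambda>k. q k j)))"
proof -
  define V where "V = total_variance S T w (\<lambda>k j. sqrt (q k j))"
  have V_eq: "V = 1 - (\<Sum>j\<in>T. (\<Sum>k\<in>S. w k * sqrt (q k j))\<^sup>2)"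
    by (simp add: V_def total_variance_sqrt_eq w_sum pos mass less_imp_le)
  have V_nonneg: "0 \<le> V"
    unfolding V_def total_variance_def
    by (intro sum_nonneg mult_nonneg_nonneg w_nonneg) auto
  have "l1_dispersion S T w q \<le> V + sqrt V * sqrt (4 - 3 * V)"
    unfolding V_def
    by (rule l1_dispersion_le_total_variance_sqrt) (simp_all add: pos mass less_imp_le)
  also have "\<dots> = sqrt V * (sqrt V + sqrt (4 - 3 * V))"
    using V_nonneg by (simp add: distrib_left)
  finally have "l1_dispersion S T w q \<le> sqrt V * (sqrt V + sqrt (4 - 3 * V))" .
  moreover have "0 \<le> l1_dispersion S T w q"
    unfolding l1_dispersion_def by (intro sum_nonneg mult_nonneg_nonneg w_nonneg) auto
  ultimately have "(l1_dispersion S T w q)\<^sup>2 \<le> (sqrt V * (sqrt V + sqrt (4 - 3 * V)))\<^sup>2"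
    by (intro power_mono)
  also have "\<dots> = V * (sqrt V + sqrt (4 - 3 * V))\<^sup>2"
    using V_nonneg by (simp add: power_mult_distrib)
  also have "\<dots> \<le> V * (16 / 3)"
  proof (rule mult_left_mono[OF _ V_nonneg])
    have "0 \<le> (3 * sqrt V - sqrt (4 - 3 * V))\<^sup>2" by simp
    moreover have "V \<le> 1" by (simp add: V_eq sum_nonneg)
    ultimately show "(sqrt V + sqrt (4 - 3 * V))\<^sup>2 \<le> 16 / 3"
      using V_nonneg by (simp add: power2_sum power2_diff power_mult_distrib)
  qed
  also have "V \<le> 1 - (\<Sum>j\<in>T. geometric_mean S w (\<lambda>k. q k j))"
    unfolding V_eq
    by (intro diff_left_mono sum_mono geometric_mean_le_weighted_sqrt_square pos)
  finally show ?thesis by simp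
qed

text \<open>
  Vectors \<open>y k\<close> with vanishing weighted mean are orthogonal to the common part of the \<open>q k\<close>, so
  the \<open>q k\<close> may be centred.
\<close>

lemma weighted_inner_le_l1_dispersion:
  fixes q y :: "'a \<Rightarrow> 'b \<Rightarrow> real"
  assumes mean_zero: "\<And>j. j \<in> T \<Longrightarrow> (\<Sum>k\<in>S. w k * y k j) = 0"
    and osc: "\<And>k i j. k \<in> S \<Longrightarrow> i \<in> T \<Longrightarrow> j \<in> T \<Longrightarrow> y k i - y k j \<le> 2 * R"
    and mass: "\<And>k. k \<in> S \<Longrightarrow> (\<Sum>j\<in>T. q k j) = 1"
  shows "(\<Sum>k\<in>S. w k * (\<Sum>j\<in>T. q k j * y k j)) \<le> R * l1_dispersion S T w q"
proof -
  define qbar where "qbar j = (\<Sum>k\<in>S. w k * q k j)" for j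
  have qbar_mass: "(\<Sum>j\<in>T. qbar j) = 1"
    unfolding qbar_def by (subst sum.swap) (simp add: mass w_sum flip: sum_distrib_left)
  have "(\<Sum>k\<in>S. w k * (\<Sum>j\<in>T. qbar j * y k j)) = (\<Sum>j\<in>T. qbar j * (\<Sum>k\<in>S. w k * y k j))"
    unfolding sum_distrib_left by (subst sum.swap) (simp add: mult_ac)
  also have "\<dots> = 0" by (simp add: mean_zero)
  finally have "(\<Sum>k\<in>S. w k * (\<Sum>j\<in>T. q k j * y k j))
      = (\<Sum>k\<in>S. w k * (\<Sum>j\<in>T. (q k j - qbar j) * y k j))"
    by (simp add: left_diff_distrib right_diff_distrib sum_subtractf)
  also have "\<dots> \<le> (\<Sum>k\<in>S. w k * (R * (\<Sum>j\<in>T. \<bar>q k j - qbar j\<bar>)))"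
    by (intro sum_mono mult_left_mono sum_mult_le_oscillation)
      (auto intro: osc w_nonneg simp: sum_subtractf mass qbar_mass)
  finally show ?thesis
    by (simp add: l1_dispersion_def qbar_def sum_distrib_left mult_ac)
qed

end

section \<open>Descent sequences\<close>

lemma quadratic_decrease_bound:
  fixes y :: "nat \<Rightarrow> real"
  assumes pos: "\<And>k. k \<le> M \<Longrightarrow> 0 < y k"
    and decrease: "\<And>k. k < M \<Longrightarrow> (y k)\<^sup>2 \<le> c * (y k - y (Suc k))"
    and "0 \<le> c"
  shows "real M * y M \<le> c"
  using pos decrease
proof (induction M)
  case (Suc M)
  have y_pos: "0 < y M" "0 < y (Suc M)" using Suc.prems(1) by auto
  have decrease: "(y M)\<^sup>2 \<le> c * (y M - y (Suc M))" using Suc.prems(2) by simp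
  have "0 < (y M)\<^sup>2" using y_pos by simp
  with decrease have "0 < c * (y M - y (Suc M))" by linarith
  then have "y (Suc M) < y M" using \<open>0 \<le> c\<close> by (simp add: zero_less_mult_iff)
  then have "y M * y (Suc M) \<le> (y M)\<^sup>2"
    using y_pos by (simp add: power2_eq_square)
  moreover have "real M * y M * y (Suc M) \<le> c * y (Suc M)"
    using Suc.IH Suc.prems y_pos by (intro mult_right_mono) (auto simp: less_imp_le)
  ultimately have "y M * (real (Suc M) * y (Suc M)) \<le> y M * c"
    using decrease by (simp add: algebra_simps)
  then show ?case using y_pos by simp
qed (use \<open>0 \<le> c\<close> in simp)

text \<open>
  Adding \<open>R \<epsilon>\<close> to \<open>F k - F M\<close> gives a quantity which is at most \<open>2 R g k\<close>, hence decreases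
  quadratically, and ends at the positive value \<open>R \<epsilon>\<close>.
\<close>

lemma descent_steps_mult_le:
  fixes F g :: "nat \<Rightarrow> real"
  assumes "0 < A" "0 < R" "0 < \<epsilon>"
    and decrease: "\<And>k. (g k)\<^sup>2 \<le> A * (F k - F (Suc k))"
    and gap: "\<And>k l. F k - F l \<le> R * g k"
    and large: "\<And>k. k < M \<Longrightarrow> \<epsilon> < g k"
  shows "real M * (R * \<epsilon>) \<le> 4 * A * R\<^sup>2"
proof -
  have "F (Suc k) \<le> F k" for k
    using order_trans[OF zero_le_power2 decrease[of k]] \<open>0 < A\<close> by (simp add: zero_le_mult_iff)
  then have "decseq F" by (rule decseq_SucI)
  define y where "y k = F k - F M + R * \<epsilon>" for k
  have "real M * y M \<le> 4 * A * R\<^sup>2"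
  proof (rule quadratic_decrease_bound)
    show y_pos: "0 < y k" if "k \<le> M" for k
    proof -
      have "F M \<le> F k" using \<open>decseq F\<close> that by (rule decseqD)
      moreover have "0 < R * \<epsilon>" using \<open>0 < R\<close> \<open>0 < \<epsilon>\<close> by simp
      ultimately show ?thesis by (simp add: y_def)
    qed
    show "(y k)\<^sup>2 \<le> 4 * A * R\<^sup>2 * (y k - y (Suc k))" if "k < M" for k
    proof -
      have "R * \<epsilon> \<le> R * g k" using large[OF that] \<open>0 < R\<close> by simp
      then have "y k \<le> 2 * R * g k" using gap[of k M] by (simp add: y_def)
      then have "(y k)\<^sup>2 \<le> (2 * R * g k)\<^sup>2" using y_pos[of k] that by (intro power_mono) auto
      also have "\<dots> = 4 * R\<^sup>2 * (g k)\<^sup>2" by (simp add: power_mult_distrib)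
      also have "\<dots> \<le> 4 * R\<^sup>2 * (A * (F k - F (Suc k)))" by (intro mult_left_mono decrease) simp
      finally show ?thesis by (simp add: y_def mult_ac)
    qed
  qed (use \<open>0 < A\<close> in simp)
  then show ?thesis by (simp add: y_def)
qed

lemma descent_steps_le:
  fixes F g :: "nat \<Rightarrow> real"
  assumes "0 < A" "0 \<le> R" "0 < \<epsilon>"
    and decrease: "\<And>k. (g k)\<^sup>2 \<le> A * (F k - F (Suc k))"
    and gap: "\<And>k l. F k - F l \<le> R * g k"
    and large: "\<And>k. k < M \<Longrightarrow> \<epsilon> < g k"
  shows "real M \<le> 4 * A * R / \<epsilon>"
proof (cases "R = 0")
  case True
  have "\<not> 0 < M"
  proof
    assume "0 < M"
    then have "0 < (g 0)\<^sup>2" using large[of 0] \<open>0 < \<epsilon>\<close> by simp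
    also have "\<dots> \<le> A * (F 0 - F 1)" using decrease[of 0] by simp
    also have "\<dots> \<le> 0" using gap[of 0 1] True \<open>0 < A\<close> by (simp add: mult_le_0_iff)
    finally show False by simp
  qed
  then show ?thesis using True by simp
next
  case False
  with \<open>0 \<le> R\<close> have "0 < R" by simp
  with \<open>0 < A\<close> have "real M * (R * \<epsilon>) \<le> 4 * A * R\<^sup>2"
    using \<open>0 < \<epsilon>\<close> decrease gap large by (rule descent_steps_mult_le)
  then have "R * (real M * \<epsilon>) \<le> R * (4 * A * R)" by (simp add: power2_eq_square mult_ac)
  then show ?thesis using \<open>0 < R\<close> \<open>0 < \<epsilon>\<close> by (simp add: pos_le_divide_eq)
qed

lemma descent_stopping_index:
  fixes F g :: "nat \<Rightarrow> real"
  assumes "0 < A" "0 \<le> R" "0 < \<epsilon>"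
    and decrease: "\<And>k. (g k)\<^sup>2 \<le> A * (F k - F (Suc k))"
    and gap: "\<And>k l. F k - F l \<le> R * g k"
  obtains k where "g k \<le> \<epsilon>" "\<And>i. i < k \<Longrightarrow> \<epsilon> < g i" "real k \<le> 4 * A * R / \<epsilon>"
proof -
  have steps: "real M \<le> 4 * A * R / \<epsilon>" if "\<And>k. k < M \<Longrightarrow> \<epsilon> < g k" for M
    using assms that by (rule descent_steps_le)
  have "\<exists>k. g k \<le> \<epsilon>"
  proof (rule ccontr)
    assume "\<not> ?thesis"
    then have "real M \<le> 4 * A * R / \<epsilon>" for M using steps by (simp add: not_le)
    then show False using reals_Archimedean2 by (metis not_le)
  qed
  then obtain k where "g k \<le> \<epsilon>" "\<And>i. i < k \<Longrightarrow> \<epsilon> < g i"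
    by (auto simp: exists_least_iff[of "\<lambda>k. g k \<le> \<epsilon>"] not_le)
  with steps that show ?thesis by blast
qed

section \<open>Gibbs plans\<close>

text \<open>Where \<open>\<pi> i j > 0 = \<kappa> i j\<close> the summand is junk rather than infinite.\<close>

definition rel_entropy :: "nat \<Rightarrow> (nat \<Rightarrow> nat \<Rightarrow> real) \<Rightarrow> (nat \<Rightarrow> nat \<Rightarrow> real) \<Rightarrow> real" where
  "rel_entropy n \<pi> \<kappa> = (\<Sum>i<n. \<Sum>j<n. \<pi> i j * (ln (\<pi> i j) - ln (\<kappa> i j)))"

definition col_sum :: "nat \<Rightarrow> (nat \<Rightarrow> nat \<Rightarrow> real) \<Rightarrow> nat \<Rightarrow> real" where
  "col_sum n A j = (\<Sum>i<n. A i j)"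

definition row_partition :: "nat \<Rightarrow> (nat \<Rightarrow> nat \<Rightarrow> real) \<Rightarrow> (nat \<Rightarrow> real) \<Rightarrow> nat \<Rightarrow> real" where
  "row_partition n K y = mat_vec n K (\<lambda>j. exp (y j))"

definition log_partition ::
  "nat \<Rightarrow> (nat \<Rightarrow> nat \<Rightarrow> real) \<Rightarrow> (nat \<Rightarrow> real) \<Rightarrow> (nat \<Rightarrow> real) \<Rightarrow> real" where
  "log_partition n K p y = (\<Sum>i<n. p i * ln (row_partition n K y i))"

definition gibbs_plan ::
  "nat \<Rightarrow> (nat \<Rightarrow> nat \<Rightarrow> real) \<Rightarrow> (nat \<Rightarrow> real) \<Rightarrow> (nat \<Rightarrow> real) \<Rightarrow> nat \<Rightarrow> nat \<Rightarrow> real" where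
  "gibbs_plan n K p y = (\<lambda>i j. p i / row_partition n K y i * K i j * exp (y j))"

lemma mat_vec_transpose_ones: "mat_vec n (mat_transpose A) ones = col_sum n A"
  by (simp add: mat_vec_def mat_transpose_def ones_def col_sum_def fun_eq_iff)

lemma diff_le_mult_ln_diff:
  fixes x y :: real
  assumes "0 \<le> x" and "0 \<le> y" and "y = 0 \<Longrightarrow> x = 0"
  shows "x - y \<le> x * (ln x - ln y)"
proof (cases "x = 0")
  case False
  then have "0 < x" "0 < y" using assms by (auto simp: order_less_le)
  then have "x * (ln y - ln x) \<le> x * (y / x - 1)"
    using ln_le_minus_one[of "y / x"] by (simp add: ln_div)
  then show ?thesis using \<open>0 < x\<close> by (simp add: algebra_simps)
qed (use assms in simp)

lemma rel_entropy_self: "rel_entropy n \<pi> \<pi> = 0"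
  by (simp add: rel_entropy_def)

lemma sum_diff_le_rel_entropy:
  assumes "\<And>i j. i < n \<Longrightarrow> j < n \<Longrightarrow> 0 \<le> \<pi> i j"
    and "\<And>i j. i < n \<Longrightarrow> j < n \<Longrightarrow> 0 \<le> \<kappa> i j"
    and "\<And>i j. i < n \<Longrightarrow> j < n \<Longrightarrow> \<kappa> i j = 0 \<Longrightarrow> \<pi> i j = 0"
  shows "(\<Sum>i<n. \<Sum>j<n. \<pi> i j) - (\<Sum>i<n. \<Sum>j<n. \<kappa> i j) \<le> rel_entropy n \<pi> \<kappa>"
  unfolding rel_entropy_def sum_subtractf[symmetric]
  by (intro sum_mono diff_le_mult_ln_diff) (use assms in auto)

lemma frob_plus_entropy_eq_rel_entropy:
  assumes "\<gamma> \<noteq> 0"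
  shows "frob n C \<pi> + \<gamma> * entropy n \<pi>
           = \<gamma> * (rel_entropy n \<pi> (kernel \<gamma> C) - (\<Sum>i<n. \<Sum>j<n. \<pi> i j))"
  unfolding frob_def entropy_def rel_entropy_def kernel_def sum_distrib_left
    sum.distrib[symmetric] sum_subtractf[symmetric]
  by (intro sum.cong refl) (use assms in \<open>simp add: algebra_simps\<close>)

lemma col_sum_gibbs_plan:
  "col_sum n (gibbs_plan n K p y) j
     = exp (y j) * mat_vec n (mat_transpose K) (\<lambda>i. p i / row_partition n K y i) j"
  by (simp add: col_sum_def gibbs_plan_def mat_vec_def mat_transpose_def sum_distrib_left mult_ac)

context
  fixes n :: nat and K :: "nat \<Rightarrow> nat \<Rightarrow> real"
  assumes K_pos: "\<And>i j. i < n \<Longrightarrow> j < n \<Longrightarrow> 0 < K i j"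
begin

lemma row_partition_pos: "i < n \<Longrightarrow> 0 < row_partition n K y i"
  unfolding row_partition_def mat_vec_def by (intro sum_pos) (auto simp: K_pos)

lemma gibbs_plan_pos: "i < n \<Longrightarrow> j < n \<Longrightarrow> 0 < p i \<Longrightarrow> 0 < gibbs_plan n K p y i j"
  by (simp add: gibbs_plan_def K_pos row_partition_pos)

lemma gibbs_plan_row_sum: "i < n \<Longrightarrow> (\<Sum>j<n. gibbs_plan n K p y i j) = p i"
proof -
  assume "i < n"
  have "(\<Sum>j<n. gibbs_plan n K p y i j) = p i / row_partition n K y i * row_partition n K y i"
    by (subst (2) row_partition_def)
      (simp add: gibbs_plan_def mat_vec_def sum_distrib_left mult.assoc)
  then show ?thesis using row_partition_pos[OF \<open>i < n\<close>, of y] by simp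
qed

lemma col_sum_gibbs_plan_total: "(\<Sum>j<n. col_sum n (gibbs_plan n K p y) j) = (\<Sum>i<n. p i)"
  unfolding col_sum_def by (subst sum.swap) (simp add: gibbs_plan_row_sum)

context
  fixes p :: "nat \<Rightarrow> real"
  assumes p_nonneg: "\<And>i. i < n \<Longrightarrow> 0 \<le> p i"
begin

lemma gibbs_plan_nonneg: "i < n \<Longrightarrow> j < n \<Longrightarrow> 0 \<le> gibbs_plan n K p y i j"
  by (simp add: gibbs_plan_def K_pos p_nonneg row_partition_pos less_imp_le)

text \<open>
  The logarithm of a Gibbs plan is that of \<open>K\<close> up to terms depending on the row or on the column
  only.
\<close>

lemma rel_entropy_gibbs_plan_decomposition:
  assumes nonneg: "\<And>i j. i < n \<Longrightarrow> j < n \<Longrightarrow> 0 \<le> \<pi> i j"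
    and row_sum: "\<And>i. i < n \<Longrightarrow> (\<Sum>j<n. \<pi> i j) = p i"
  shows "rel_entropy n \<pi> K = rel_entropy n \<pi> (gibbs_plan n K p y) + (\<Sum>i<n. p i * ln (p i))
           - log_partition n K p y + (\<Sum>j<n. col_sum n \<pi> j * y j)"
proof -
  let ?B = "gibbs_plan n K p y" and ?Z = "row_partition n K y"
  have entry: "\<pi> i j * (ln (\<pi> i j) - ln (K i j))
      = \<pi> i j * (ln (\<pi> i j) - ln (?B i j)) + \<pi> i j * (ln (p i) - ln (?Z i)) + \<pi> i j * y j"
    if "i < n" "j < n" for i j
  proof (cases "p i = 0")
    case True
    then have "\<pi> i j = 0"
      using row_sum nonneg that
      by (intro sum_nonneg_0[of "{..<n}" "\<pi> i"]) auto
    then show ?thesis by simp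
  next
    case False
    then have ln_B: "ln (?B i j) = ln (p i) - ln (?Z i) + ln (K i j) + y j"
      using p_nonneg[OF that(1)] row_partition_pos[OF that(1), of y] K_pos[OF that]
      by (simp add: gibbs_plan_def ln_mult ln_div)
    show ?thesis unfolding ln_B by (simp add: algebra_simps)
  qed
  have "rel_entropy n \<pi> K = rel_entropy n \<pi> ?B + (\<Sum>i<n. \<Sum>j<n. \<pi> i j * (ln (p i) - ln (?Z i)))
      + (\<Sum>i<n. \<Sum>j<n. \<pi> i j * y j)"
    by (simp add: rel_entropy_def entry sum.distrib cong: sum.cong_simp)
  also have "(\<Sum>i<n. \<Sum>j<n. \<pi> i j * (ln (p i) - ln (?Z i)))
      = (\<Sum>i<n. p i * ln (p i)) - log_partition n K p y"
    by (simp add: row_sum log_partition_def right_diff_distrib sum_subtractf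
        flip: sum_distrib_right)
  also have "(\<Sum>i<n. \<Sum>j<n. \<pi> i j * y j) = (\<Sum>j<n. col_sum n \<pi> j * y j)"
    unfolding col_sum_def sum_distrib_right by (rule sum.swap)
  finally show ?thesis by simp
qed

lemma rel_entropy_gibbs_plan_nonneg:
  assumes nonneg: "\<And>i j. i < n \<Longrightarrow> j < n \<Longrightarrow> 0 \<le> \<pi> i j"
    and row_sum: "\<And>i. i < n \<Longrightarrow> (\<Sum>j<n. \<pi> i j) = p i"
  shows "0 \<le> rel_entropy n \<pi> (gibbs_plan n K p y)"
proof -
  have "\<pi> i j = 0" if "i < n" "j < n" "gibbs_plan n K p y i j = 0" for i j
  proof -
    have "p i = 0"
      using that gibbs_plan_pos[OF that(1,2), of p y] p_nonneg[OF that(1)] by fastforce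
    then show ?thesis
      using row_sum nonneg that by (intro sum_nonneg_0[of "{..<n}" "\<pi> i"]) auto
  qed
  then show ?thesis
    using sum_diff_le_rel_entropy[of n \<pi> "gibbs_plan n K p y"]
    by (simp add: nonneg gibbs_plan_nonneg row_sum gibbs_plan_row_sum)
qed

lemma rel_entropy_gibbs_plan_diff_le:
  assumes "\<And>i j. i < n \<Longrightarrow> j < n \<Longrightarrow> 0 \<le> \<pi> i j"
    and "\<And>i. i < n \<Longrightarrow> (\<Sum>j<n. \<pi> i j) = p i"
  shows "rel_entropy n (gibbs_plan n K p y) K - rel_entropy n \<pi> K
           \<le> (\<Sum>j<n. col_sum n (gibbs_plan n K p y) j * y j) - (\<Sum>j<n. col_sum n \<pi> j * y j)"
  using rel_entropy_gibbs_plan_decomposition[OF assms, of y]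
    rel_entropy_gibbs_plan_nonneg[OF assms, of y]
    rel_entropy_gibbs_plan_decomposition[of "gibbs_plan n K p y" y]
  by (simp add: gibbs_plan_nonneg gibbs_plan_row_sum rel_entropy_self)

text \<open>The column sums of a Gibbs plan are the gradient of the convex \<open>log_partition n K p\<close>.\<close>

lemma log_partition_diff_le_inner:
  "log_partition n K p y - log_partition n K p y'
     \<le> (\<Sum>j<n. col_sum n (gibbs_plan n K p y) j * (y j - y' j))"
  using rel_entropy_gibbs_plan_decomposition[of "gibbs_plan n K p y" y]
    rel_entropy_gibbs_plan_decomposition[of "gibbs_plan n K p y" y']
    rel_entropy_gibbs_plan_nonneg[of "gibbs_plan n K p y" y']
  by (simp add: gibbs_plan_nonneg gibbs_plan_row_sum rel_entropy_self
      right_diff_distrib sum_subtractf)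

lemma log_partition_diff_le_exp:
  "log_partition n K p y' - log_partition n K p y
     \<le> (\<Sum>j<n. col_sum n (gibbs_plan n K p y) j * (exp (y' j - y j) - 1))"
proof -
  let ?Z = "row_partition n K"
  have row: "p i * (?Z y' i / ?Z y i - 1) = (\<Sum>j<n. gibbs_plan n K p y i j * (exp (y' j - y j) - 1))"
    if "i < n" for i
  proof -
    have "p i * (?Z y' i / ?Z y i) = (\<Sum>j<n. gibbs_plan n K p y i j * exp (y' j - y j))"
      by (simp add: gibbs_plan_def row_partition_def[of n K y'] mat_vec_def sum_distrib_left
          sum_divide_distrib exp_diff mult_ac)
    then show ?thesis by (simp add: right_diff_distrib sum_subtractf gibbs_plan_row_sum that)
  qed
  have "log_partition n K p y' - log_partition n K p y = (\<Sum>i<n. p i * ln (?Z y' i / ?Z y i))"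
    unfolding log_partition_def sum_subtractf[symmetric]
    by (intro sum.cong) (simp_all add: row_partition_pos ln_divide_pos right_diff_distrib)
  also have "\<dots> \<le> (\<Sum>i<n. p i * (?Z y' i / ?Z y i - 1))"
    by (intro sum_mono mult_left_mono ln_le_minus_one) (auto simp: row_partition_pos p_nonneg)
  also have "\<dots> = (\<Sum>i<n. \<Sum>j<n. gibbs_plan n K p y i j * (exp (y' j - y j) - 1))"
    by (simp add: row)
  also have "\<dots> = (\<Sum>j<n. col_sum n (gibbs_plan n K p y) j * (exp (y' j - y j) - 1))"
    unfolding col_sum_def sum_distrib_right by (rule sum.swap)
  finally show ?thesis .
qed

end

end

lemma mat_vec_transpose_pos:
  assumes "\<And>i. i < n \<Longrightarrow> 0 < K i j" and "\<And>i. i < n \<Longrightarrow> 0 \<le> a i" and "0 < (\<Sum>i<n. a i)"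
  shows "0 < mat_vec n (mat_transpose K) a j"
proof -
  obtain i where "i < n" "a i \<noteq> 0"
    using assms(3) by (metis lessThan_iff less_irrefl sum.neutral)
  with assms(2) have "0 < a i" by (simp add: order_less_le)
  with \<open>i < n\<close> show ?thesis
    unfolding mat_vec_def mat_transpose_def
    by (intro sum_pos2[of _ i]) (auto simp: assms less_imp_le)
qed

lemma kernel_pos: "0 < kernel \<gamma> C i j"
  by (simp add: kernel_def)

lemma ln_mat_vec_transpose_kernel_diff_le:
  assumes "0 < \<gamma>" and C: "\<And>i. i < n \<Longrightarrow> 0 \<le> C i j" "\<And>i. i < n \<Longrightarrow> C i j' \<le> M"
    and a: "\<And>i. i < n \<Longrightarrow> 0 \<le> a i" "0 < (\<Sum>i<n. a i)"
  shows "ln (mat_vec n (mat_transpose (kernel \<gamma> C)) a j)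
           - ln (mat_vec n (mat_transpose (kernel \<gamma> C)) a j') \<le> M / \<gamma>"
proof -
  let ?Ka = "mat_vec n (mat_transpose (kernel \<gamma> C)) a"
  have pos: "0 < ?Ka j" for j by (intro mat_vec_transpose_pos a kernel_pos)
  have "kernel \<gamma> C i j \<le> exp (M / \<gamma>) * kernel \<gamma> C i j'" if "i < n" for i
  proof -
    have "- C i j / \<gamma> \<le> 0" using C(1)[OF that] \<open>0 < \<gamma>\<close> by simp
    also have "\<dots> \<le> M / \<gamma> - C i j' / \<gamma>"
      using C(2)[OF that] \<open>0 < \<gamma>\<close> by (simp add: divide_right_mono)
    finally have "- C i j / \<gamma> \<le> M / \<gamma> - C i j' / \<gamma>" .
    then show ?thesis by (simp add: kernel_def flip: exp_add)
  qed
  then have "?Ka j \<le> exp (M / \<gamma>) * ?Ka j'"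
    unfolding mat_vec_def mat_transpose_def sum_distrib_left
    by (intro sum_mono) (simp add: a mult_right_mono flip: mult.assoc)
  then have "ln (?Ka j) \<le> ln (exp (M / \<gamma>) * ?Ka j')" using pos by simp
  then show ?thesis using pos[of j'] by (simp add: ln_mult)
qed

lemma feasible_nonneg:
  "feasible m n p \<pi> \<Longrightarrow> l < m \<Longrightarrow> i < n \<Longrightarrow> j < n \<Longrightarrow> 0 \<le> \<pi> l i j"
  by (simp add: feasible_def)

lemma feasible_row_sum: "feasible m n p \<pi> \<Longrightarrow> l < m \<Longrightarrow> i < n \<Longrightarrow> (\<Sum>j<n. \<pi> l i j) = p l i"
  by (simp add: feasible_def mat_vec_def ones_def)

lemma feasible_col_sum_eq:
  "feasible m n p \<pi> \<Longrightarrow> k < m \<Longrightarrow> l < m \<Longrightarrow> j < n \<Longrightarrow> col_sum n (\<pi> k) j = col_sum n (\<pi> l) j"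
  unfolding feasible_def mat_vec_transpose_ones by blast

section \<open>The algorithm\<close>

locale barycenter_problem =
  fixes m n :: nat
    and p :: "nat \<Rightarrow> nat \<Rightarrow> real"
    and C :: "nat \<Rightarrow> nat \<Rightarrow> nat \<Rightarrow> real"
    and w :: "nat \<Rightarrow> real"
    and \<gamma> :: real
  assumes data: "barycenter_data m n p C w \<gamma>"
begin

lemma m_pos: "0 < m" and n_pos: "0 < n" and gamma_pos: "0 < \<gamma>" and w_sum: "(\<Sum>l<m. w l) = 1"
  using data by (auto simp: barycenter_data_def)

lemma w_nonneg: "l < m \<Longrightarrow> 0 \<le> w l"
  using data by (auto simp: barycenter_data_def)

lemma p_nonneg: "l < m \<Longrightarrow> i < n \<Longrightarrow> 0 \<le> p l i"
  using data by (auto simp: barycenter_data_def prob_simplex_def)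

lemma p_sum: "l < m \<Longrightarrow> (\<Sum>i<n. p l i) = 1"
  using data by (auto simp: barycenter_data_def prob_simplex_def)

lemma C_nonneg: "l < m \<Longrightarrow> i < n \<Longrightarrow> j < n \<Longrightarrow> 0 \<le> C l i j"
  using data by (auto simp: barycenter_data_def)

lemma C_le_max_entry: "i < n \<Longrightarrow> j < n \<Longrightarrow> C l i j \<le> max_entry n (C l)"
  unfolding max_entry_def by (rule Max_ge) force+

abbreviation K :: "nat \<Rightarrow> nat \<Rightarrow> nat \<Rightarrow> real" where
  "K l \<equiv> kernel \<gamma> (C l)"

abbreviation transpose_image :: "(nat \<Rightarrow> nat \<Rightarrow> real) \<Rightarrow> nat \<Rightarrow> nat \<Rightarrow> real" where
  "transpose_image a l \<equiv> mat_vec n (mat_transpose (K l)) (a l)"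

abbreviation max_cost :: real where
  "max_cost \<equiv> MAX l\<in>{..<m}. max_entry n (C l)"

abbreviation plan :: "(nat \<Rightarrow> nat \<Rightarrow> real) \<Rightarrow> nat \<Rightarrow> nat \<Rightarrow> nat \<Rightarrow> real" where
  "plan y l \<equiv> gibbs_plan n (K l) (p l) (y l)"

abbreviation marginal :: "(nat \<Rightarrow> nat \<Rightarrow> real) \<Rightarrow> nat \<Rightarrow> nat \<Rightarrow> real" where
  "marginal y l \<equiv> col_sum n (plan y l)"

abbreviation dispersion :: "(nat \<Rightarrow> nat \<Rightarrow> real) \<Rightarrow> real" where
  "dispersion y \<equiv> l1_dispersion {..<m} {..<n} w (marginal y)"

text \<open>
  The half-steps in terms of \<open>a l = exp (u l)\<close>, which is real where \<open>u l\<close> may be \<open>-\<infinity>\<close>, and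
  \<open>y l = v l\<close>.  At the counter value \<open>2 * Suc k\<close> these are \<open>scaling (Suc k)\<close> and \<open>potential k\<close>.
\<close>

definition potential_update :: "(nat \<Rightarrow> nat \<Rightarrow> real) \<Rightarrow> nat \<Rightarrow> nat \<Rightarrow> real" where
  "potential_update a l j =
     (\<Sum>k<m. w k * ln (transpose_image a k j)) - ln (transpose_image a l j)"

definition scaling_update :: "(nat \<Rightarrow> nat \<Rightarrow> real) \<Rightarrow> nat \<Rightarrow> nat \<Rightarrow> real" where
  "scaling_update y l = (\<lambda>i. p l i / row_partition n (K l) (y l) i)"

primrec scaling :: "nat \<Rightarrow> nat \<Rightarrow> nat \<Rightarrow> real" where
  "scaling 0 = (\<lambda>_ _. 1)"
| "scaling (Suc k) = scaling_update (potential_update (scaling k))"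

definition potential :: "nat \<Rightarrow> nat \<Rightarrow> nat \<Rightarrow> real" where
  "potential k = potential_update (scaling k)"

lemma scaling_update_nonneg: "l < m \<Longrightarrow> i < n \<Longrightarrow> 0 \<le> scaling_update y l i"
  by (simp add: scaling_update_def p_nonneg row_partition_pos kernel_pos less_imp_le)

lemma scaling_update_sum_pos:
  assumes "l < m"
  shows "0 < (\<Sum>i<n. scaling_update y l i)"
proof -
  have "\<not> (\<forall>i\<in>{..<n}. p l i = 0)"
    using p_sum[OF assms] by (metis sum.neutral zero_neq_one)
  then obtain i where "i < n" "p l i \<noteq> 0" by blast
  then have "0 < scaling_update y l i"
    using p_nonneg[OF assms, of i] by (simp add: scaling_update_def row_partition_pos kernel_pos)
  with \<open>i < n\<close> show ?thesis
    by (intro sum_pos2[of _ i]) (auto simp: scaling_update_nonneg assms)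
qed

lemma scaling_nonneg: "l < m \<Longrightarrow> i < n \<Longrightarrow> 0 \<le> scaling k l i"
  by (cases k) (simp_all add: scaling_update_nonneg)

lemma scaling_sum_pos: "l < m \<Longrightarrow> 0 < (\<Sum>i<n. scaling k l i)"
  by (cases k) (simp_all add: scaling_update_sum_pos n_pos)

lemma transpose_image_scaling_pos:
  "l < m \<Longrightarrow> 0 < transpose_image (scaling k) l j"
  by (intro mat_vec_transpose_pos) (simp_all add: kernel_pos scaling_nonneg scaling_sum_pos)

lemma v_step_eq:
  assumes u: "\<And>k i. k < m \<Longrightarrow> i < n \<Longrightarrow> exp_ext (u k i) = a k i"
    and pos: "\<And>k. k < m \<Longrightarrow> 0 < transpose_image a k j"
    and "l < m"
  shows "v_step m n C w \<gamma> u l j = ereal (potential_update a l j)"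
proof -
  have "ln_ext (mat_vec n (mat_transpose (K k)) (\<lambda>i. exp_ext (u k i)) j)
      = ereal (ln (transpose_image a k j))" if "k < m" for k
  proof -
    have "mat_vec n (mat_transpose (K k)) (\<lambda>i. exp_ext (u k i)) j = transpose_image a k j"
      by (simp add: mat_vec_def u that)
    then show ?thesis using pos[OF that] by (simp add: ln_ext_def)
  qed
  then show ?thesis by (simp add: v_step_def potential_update_def \<open>l < m\<close>)
qed

lemma exp_ext_u_step_eq:
  assumes v: "\<And>j. j < n \<Longrightarrow> v l j = ereal (y l j)" and "l < m" "i < n"
  shows "exp_ext (u_step n p C \<gamma> v l i) = scaling_update y l i"
proof -
  have image_eq: "mat_vec n (K l) (\<lambda>j. exp_ext (v l j)) i = row_partition n (K l) (y l) i"
    by (simp add: mat_vec_def row_partition_def v exp_ext_def)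
  have "0 < row_partition n (K l) (y l) i"
    using assms(3) by (simp add: row_partition_pos kernel_pos)
  with p_nonneg[OF assms(2,3)] show ?thesis
    unfolding u_step_def image_eq scaling_update_def
    by (auto simp: ln_ext_def exp_ext_def exp_diff)
qed

lemma dibp_even_Suc:
  "dibp m n p C w \<gamma> (2 * Suc k) =
     (u_step n p C \<gamma> (v_step m n C w \<gamma> (fst (dibp m n p C w \<gamma> (2 * k)))),
      v_step m n C w \<gamma> (fst (dibp m n p C w \<gamma> (2 * k))))"
  by (simp add: case_prod_unfold)

lemma exp_ext_fst_dibp:
  "l < m \<Longrightarrow> i < n \<Longrightarrow> exp_ext (fst (dibp m n p C w \<gamma> (2 * k)) l i) = scaling k l i"
proof (induction k arbitrary: l i)
  case 0
  then show ?case by (simp add: exp_ext_def)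
next
  case (Suc k)
  then show ?case
    unfolding dibp_even_Suc
    by (simp add: exp_ext_u_step_eq v_step_eq transpose_image_scaling_pos del: dibp.simps)
qed

lemma snd_dibp: "l < m \<Longrightarrow> snd (dibp m n p C w \<gamma> (2 * Suc k)) l j = ereal (potential k l j)"
  unfolding dibp_even_Suc potential_def
  by (simp add: v_step_eq exp_ext_fst_dibp transpose_image_scaling_pos del: dibp.simps)

lemma dibp_plan_eq:
  assumes "l < m" "i < n"
  shows "dibp_plan m n p C w \<gamma> (2 * Suc k) l i j = plan (potential k) l i j"
proof -
  have "exp_ext (snd (dibp m n p C w \<gamma> (2 * Suc k)) l j) = exp (potential k l j)"
    unfolding snd_dibp[OF assms(1)] by (simp add: exp_ext_def)
  then show ?thesis
    unfolding dibp_plan_def case_prod_unfold scaled_kernel_def gibbs_plan_def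
      exp_ext_fst_dibp[OF assms] by (simp add: scaling_update_def potential_def)
qed

lemma marginal_gap_dibp_plan:
  "marginal_gap m n w (dibp_plan m n p C w \<gamma> (2 * Suc k)) = dispersion (potential k)"
  by (simp add: marginal_gap_def mean_marginal_def l1_norm_def l1_dispersion_def
      mat_vec_transpose_ones col_sum_def dibp_plan_eq del: mult_Suc_right cong: sum.cong_simp)

lemma objective_dibp_plan:
  "objective m n C w \<gamma> (dibp_plan m n p C w \<gamma> (2 * Suc k))
     = objective m n C w \<gamma> (plan (potential k))"
  by (simp add: objective_def frob_def entropy_def dibp_plan_eq
      del: mult_Suc_right cong: sum.cong_simp)

lemma dibp_exit_iff:
  "dibp_exit m n p C w \<gamma> \<epsilon> t \<longleftrightarrow> (\<exists>k. t = 2 * Suc k \<and> dispersion (potential k) \<le> \<epsilon>)"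
proof
  assume exit: "dibp_exit m n p C w \<gamma> \<epsilon> t"
  then obtain k where "t = 2 * Suc k"
    unfolding dibp_exit_def by (metis evenE gr0_conv_Suc mult_0_right not_gr0)
  with exit show "\<exists>k. t = 2 * Suc k \<and> dispersion (potential k) \<le> \<epsilon>"
    by (metis dibp_exit_def marginal_gap_dibp_plan)
qed (auto simp: dibp_exit_def marginal_gap_dibp_plan simp del: mult_Suc_right)

section \<open>Convergence\<close>

definition semidual :: "(nat \<Rightarrow> nat \<Rightarrow> real) \<Rightarrow> real" where
  "semidual y = (\<Sum>l<m. w l * log_partition n (K l) (p l) (y l))"

lemma marginal_pos:
  assumes "l < m"
  shows "0 < marginal y l j"
  unfolding col_sum_gibbs_plan
  using scaling_update_nonneg[OF assms] scaling_update_sum_pos[OF assms]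
  by (intro mult_pos_pos mat_vec_transpose_pos) (auto simp: kernel_pos scaling_update_def)

lemma marginal_total: "l < m \<Longrightarrow> (\<Sum>j<n. marginal y l j) = 1"
  by (simp add: col_sum_gibbs_plan_total kernel_pos p_nonneg p_sum)

lemma potential_weighted_sum: "(\<Sum>l<m. w l * potential k l j) = 0"
  by (simp add: potential_def potential_update_def right_diff_distrib sum_subtractf w_sum
      flip: sum_distrib_right)

lemma potential_Suc:
  assumes "l < m"
  shows "potential (Suc k) l j
           = potential k l j + ln (geometric_mean {..<m} w (\<lambda>l. marginal (potential k) l j))
             - ln (marginal (potential k) l j)"
proof -
  have ln_image: "ln (transpose_image (scaling (Suc k)) l j)
      = ln (marginal (potential k) l j) - potential k l j" if "l < m" for l
  proof -
    have "marginal (potential k) l j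
        = exp (potential k l j) * transpose_image (scaling (Suc k)) l j"
      by (simp add: col_sum_gibbs_plan scaling_update_def potential_def)
    then show ?thesis
      using transpose_image_scaling_pos[OF that, of "Suc k" j] by (simp add: ln_mult)
  qed
  show ?thesis
    unfolding potential_def[of "Suc k"] potential_update_def
    by (simp add: ln_image assms right_diff_distrib sum_subtractf potential_weighted_sum
        geometric_mean_def del: scaling.simps)
qed

lemma semidual_diff_le_dispersion:
  assumes mean_zero: "\<And>j. (\<Sum>l<m. w l * y l j) = 0" "\<And>j. (\<Sum>l<m. w l * y' l j) = 0"
    and osc: "\<And>l i j. l < m \<Longrightarrow> i < n \<Longrightarrow> j < n \<Longrightarrow> y l i - y l j \<le> R"
      "\<And>l i j. l < m \<Longrightarrow> i < n \<Longrightarrow> j < n \<Longrightarrow> y' l i - y' l j \<le> R"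
  shows "semidual y - semidual y' \<le> R * dispersion y"
proof -
  have "semidual y - semidual y' \<le> (\<Sum>l<m. w l * (\<Sum>j<n. marginal y l j * (y l j - y' l j)))"
    unfolding semidual_def sum_subtractf[symmetric] right_diff_distrib[symmetric]
    by (intro sum_mono mult_left_mono log_partition_diff_le_inner)
      (auto simp: kernel_pos p_nonneg w_nonneg)
  also have "\<dots> \<le> R * dispersion y"
  proof (rule weighted_inner_le_l1_dispersion)
    show "(\<Sum>l<m. w l * (y l j - y' l j)) = 0" for j
      by (simp add: right_diff_distrib sum_subtractf mean_zero)
    show "y l i - y' l i - (y l j - y' l j) \<le> 2 * R"
      if "l \<in> {..<m}" "i \<in> {..<n}" "j \<in> {..<n}" for l i j
      using osc(1)[of l i j] osc(2)[of l j i] that by simp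
  qed (simp_all add: w_nonneg w_sum marginal_total)
  finally show ?thesis .
qed

lemma square_dispersion_le_semidual_decrease:
  "(dispersion (potential k))\<^sup>2 \<le> 16 / 3 * (semidual (potential k) - semidual (potential (Suc k)))"
proof -
  let ?y = "potential k" and ?y' = "potential (Suc k)"
  define geo where "geo j = geometric_mean {..<m} w (\<lambda>l. marginal ?y l j)" for j
  have "marginal ?y l j * (exp (?y' l j - ?y l j) - 1) = geo j - marginal ?y l j" if "l < m" for l j
    using marginal_pos[OF that, of ?y j]
    by (simp add: potential_Suc that geo_def exp_diff geometric_mean_def right_diff_distrib)
  then have mass_change: "(\<Sum>j<n. marginal ?y l j * (exp (?y' l j - ?y l j) - 1))
      = (\<Sum>j<n. geo j) - 1"
    if "l < m" for l
    by (simp add: that sum_subtractf marginal_total)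
  have "semidual ?y' - semidual ?y
      \<le> (\<Sum>l<m. w l * (\<Sum>j<n. marginal ?y l j * (exp (?y' l j - ?y l j) - 1)))"
    unfolding semidual_def sum_subtractf[symmetric] right_diff_distrib[symmetric]
    by (intro sum_mono mult_left_mono log_partition_diff_le_exp)
      (auto simp: kernel_pos p_nonneg w_nonneg)
  also have "\<dots> = (\<Sum>j<n. geo j) - 1"
    by (simp add: mass_change w_sum flip: sum_distrib_right)
  finally have decrease: "1 - (\<Sum>j<n. geo j) \<le> semidual ?y - semidual ?y'" by simp
  have "(dispersion ?y)\<^sup>2 \<le> 16 / 3 * (1 - (\<Sum>j<n. geo j))"
    unfolding geo_def
    by (rule square_l1_dispersion_le) (auto simp: w_nonneg w_sum marginal_pos marginal_total)
  also have "\<dots> \<le> 16 / 3 * (semidual ?y - semidual ?y')" using decrease by simp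
  finally show ?thesis .
qed

lemma potential_oscillation_le:
  assumes "l < m" "i < n" "j < n"
  shows "potential k l i - potential k l j
           \<le> max_entry n (C l) / \<gamma> + (\<Sum>l'<m. w l' * (max_entry n (C l') / \<gamma>))"
proof -
  let ?h = "\<lambda>l j. ln (transpose_image (scaling k) l j)"
  have osc: "?h l i - ?h l j \<le> max_entry n (C l) / \<gamma>" if "l < m" "i < n" "j < n" for l i j
    by (intro ln_mat_vec_transpose_kernel_diff_le)
      (use that in \<open>auto simp: gamma_pos C_nonneg C_le_max_entry scaling_nonneg scaling_sum_pos\<close>)
  have "(\<Sum>l'<m. w l' * ?h l' i) - (\<Sum>l'<m. w l' * ?h l' j) = (\<Sum>l'<m. w l' * (?h l' i - ?h l' j))"
    by (simp add: right_diff_distrib sum_subtractf)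
  also have "\<dots> \<le> (\<Sum>l'<m. w l' * (max_entry n (C l') / \<gamma>))"
    by (intro sum_mono mult_left_mono osc) (auto simp: w_nonneg assms)
  finally show ?thesis
    using osc[OF assms(1,3,2)] by (simp add: potential_def potential_update_def)
qed

lemma max_entry_le_max_cost: "l < m \<Longrightarrow> max_entry n (C l) \<le> max_cost"
  by (intro Max_ge) auto

lemma max_entry_nonneg: "l < m \<Longrightarrow> 0 \<le> max_entry n (C l)"
  using C_nonneg[of l 0 0] C_le_max_entry[of 0 0 l] n_pos by simp

lemma weighted_max_entry_le_max_cost:
  "(\<Sum>l<m. w l * (max_entry n (C l) / \<gamma>)) \<le> max_cost / \<gamma>"
proof -
  have "(\<Sum>l<m. w l * (max_entry n (C l) / \<gamma>)) \<le> (\<Sum>l<m. w l * (max_cost / \<gamma>))"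
    using gamma_pos
    by (intro sum_mono mult_left_mono divide_right_mono max_entry_le_max_cost) (auto simp: w_nonneg)
  then show ?thesis by (simp add: w_sum flip: sum_distrib_right sum_divide_distrib)
qed

lemma R_v_nonneg: "0 \<le> R_v m n C w \<gamma>"
proof -
  have "0 \<le> max_entry n (C 0) / \<gamma>" using max_entry_nonneg[OF m_pos] gamma_pos by simp
  also have "\<dots> \<le> (MAX l\<in>{..<m}. max_entry n (C l) / \<gamma>)" using m_pos by (intro Max_ge) auto
  finally show ?thesis
    using gamma_pos unfolding R_v_def
    by (intro add_nonneg_nonneg sum_nonneg mult_nonneg_nonneg)
      (auto simp: w_nonneg max_entry_nonneg)
qed

lemma R_v_le_max_cost: "R_v m n C w \<gamma> \<le> 2 * max_cost / \<gamma>"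
proof -
  have "(MAX l\<in>{..<m}. max_entry n (C l) / \<gamma>) \<le> max_cost / \<gamma>"
    using m_pos gamma_pos
    by (intro Max.boundedI) (auto simp: divide_right_mono max_entry_le_max_cost)
  with weighted_max_entry_le_max_cost show ?thesis by (simp add: R_v_def)
qed

lemma potential_oscillation_le_R_v:
  assumes "l < m" "i < n" "j < n"
  shows "potential k l i - potential k l j \<le> R_v m n C w \<gamma>"
proof -
  have "max_entry n (C l) / \<gamma> \<le> (MAX l\<in>{..<m}. max_entry n (C l) / \<gamma>)"
    using assms(1) by (intro Max_ge) auto
  with potential_oscillation_le[OF assms, of k] show ?thesis by (simp add: R_v_def)
qed

lemma objective_eq_rel_entropy:
  assumes "\<And>l i. l < m \<Longrightarrow> i < n \<Longrightarrow> (\<Sum>j<n. \<pi> l i j) = p l i"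
  shows "objective m n C w \<gamma> \<pi> = \<gamma> * ((\<Sum>l<m. w l * rel_entropy n (\<pi> l) (K l)) - 1)"
proof -
  have "objective m n C w \<gamma> \<pi> = (\<Sum>l<m. w l * (\<gamma> * (rel_entropy n (\<pi> l) (K l) - 1)))"
    using gamma_pos by (simp add: objective_def frob_plus_entropy_eq_rel_entropy assms p_sum)
  also have "\<dots> = \<gamma> * (\<Sum>l<m. w l * rel_entropy n (\<pi> l) (K l) - w l)"
    by (simp add: sum_distrib_left right_diff_distrib mult_ac)
  finally show ?thesis by (simp add: sum_subtractf w_sum)
qed

lemma objective_diff_le:
  assumes feas: "feasible m n p \<pi>"
    and mean_zero: "\<And>j. (\<Sum>l<m. w l * y l j) = 0"
    and osc: "\<And>l i j. l < m \<Longrightarrow> i < n \<Longrightarrow> j < n \<Longrightarrow> y l i - y l j \<le> 2 * R"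
  shows "objective m n C w \<gamma> (plan y) - objective m n C w \<gamma> \<pi> \<le> \<gamma> * (R * dispersion y)"
proof -
  define q where "q = col_sum n (\<pi> 0)"
  have col_sum: "col_sum n (\<pi> l) j = q j" if "l < m" "j < n" for l j
    using feasible_col_sum_eq[OF feas that(1) m_pos that(2)] by (simp add: q_def)
  have summand: "rel_entropy n (plan y l) (K l) - rel_entropy n (\<pi> l) (K l)
      \<le> (\<Sum>j<n. marginal y l j * y l j) - (\<Sum>j<n. q j * y l j)" if "l < m" for l
    using rel_entropy_gibbs_plan_diff_le[of n "kernel \<gamma> (C l)" "p l" "\<pi> l" "y l"] that
    by (simp add: kernel_pos p_nonneg feasible_nonneg[OF feas] feasible_row_sum[OF feas] col_sum)
  have "objective m n C w \<gamma> (plan y) - objective m n C w \<gamma> \<pi>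
      = \<gamma> * (\<Sum>l<m. w l * (rel_entropy n (plan y l) (K l) - rel_entropy n (\<pi> l) (K l)))"
    by (simp add: objective_eq_rel_entropy gibbs_plan_row_sum kernel_pos p_nonneg
        feasible_row_sum[OF feas] right_diff_distrib sum_subtractf)
  also have "\<dots> \<le> \<gamma> * (\<Sum>l<m. w l * ((\<Sum>j<n. marginal y l j * y l j) - (\<Sum>j<n. q j * y l j)))"
    using gamma_pos by (intro mult_left_mono sum_mono summand) (auto simp: w_nonneg)
  also have "(\<Sum>l<m. w l * ((\<Sum>j<n. marginal y l j * y l j) - (\<Sum>j<n. q j * y l j)))
      = (\<Sum>l<m. w l * (\<Sum>j<n. marginal y l j * y l j)) - (\<Sum>l<m. \<Sum>j<n. q j * (w l * y l j))"
    by (simp add: right_diff_distrib sum_subtractf sum_distrib_left mult_ac)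
  also have "(\<Sum>l<m. \<Sum>j<n. q j * (w l * y l j)) = 0"
    by (subst sum.swap) (simp add: mean_zero flip: sum_distrib_left)
  also have "(\<Sum>l<m. w l * (\<Sum>j<n. marginal y l j * y l j)) \<le> R * dispersion y"
    using weighted_inner_le_l1_dispersion[of "{..<m}" w "{..<n}" y R "marginal y"]
    by (simp add: w_nonneg w_sum mean_zero osc marginal_total)
  finally show ?thesis using gamma_pos by simp
qed

lemma objective_dibp_plan_diff_le:
  assumes "barycenter_solution m n p C w \<gamma> \<pi>" and "dispersion (potential k) \<le> \<epsilon>"
  shows "objective m n C w \<gamma> (dibp_plan m n p C w \<gamma> (2 * Suc k)) - objective m n C w \<gamma> \<pi>
           \<le> max_cost * \<epsilon>"
proof -
  have "objective m n C w \<gamma> (plan (potential k)) - objective m n C w \<gamma> \<pi>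
      \<le> \<gamma> * (max_cost / \<gamma> * dispersion (potential k))"
  proof (rule objective_diff_le)
    show "feasible m n p \<pi>"
      using assms(1) by (simp add: barycenter_solution_def is_arg_min_def)
    show "potential k l i - potential k l j \<le> 2 * (max_cost / \<gamma>)"
      if "l < m" "i < n" "j < n" for l i j
      using potential_oscillation_le[OF that, of k] weighted_max_entry_le_max_cost
        divide_right_mono[OF max_entry_le_max_cost[OF that(1)], of \<gamma>] gamma_pos by linarith
  qed (rule potential_weighted_sum)
  also have "\<dots> = max_cost * dispersion (potential k)" using gamma_pos by simp
  also have "\<dots> \<le> max_cost * \<epsilon>"
    using assms(2) order_trans[OF max_entry_nonneg max_entry_le_max_cost, OF m_pos m_pos]
    by (rule mult_left_mono)
  finally show ?thesis by (simp only: objective_dibp_plan)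
qed

lemma dibp_stops:
  assumes "0 < \<epsilon>"
  obtains k where "dispersion (potential k) \<le> \<epsilon>" "dibp_stops_after m n p C w \<gamma> \<epsilon> (2 * Suc k)"
    "real (2 * Suc k) \<le> 4 + 44 * R_v m n C w \<gamma> / \<epsilon>"
proof -
  obtain k where first: "dispersion (potential k) \<le> \<epsilon>"
      "\<And>i. i < k \<Longrightarrow> \<epsilon> < dispersion (potential i)"
    and k_le: "real k \<le> 4 * (16 / 3) * R_v m n C w \<gamma> / \<epsilon>"
  proof (rule descent_stopping_index[where A = "16 / 3" and F = "\<lambda>k. semidual (potential k)"
        and g = "\<lambda>k. dispersion (potential k)"])
    show "semidual (potential k) - semidual (potential i)
        \<le> R_v m n C w \<gamma> * dispersion (potential k)"
      for k i
      by (intro semidual_diff_le_dispersion potential_weighted_sum potential_oscillation_le_R_v)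
  qed (use assms R_v_nonneg square_dispersion_le_semidual_decrease in auto)
  have "dibp_stops_after m n p C w \<gamma> \<epsilon> (2 * Suc k)"
    unfolding dibp_stops_after_def dibp_exit_iff using first by force
  moreover have "real (2 * Suc k) \<le> 4 + 44 * R_v m n C w \<gamma> / \<epsilon>"
  proof -
    have "0 \<le> R_v m n C w \<gamma> / \<epsilon>" using R_v_nonneg assms by simp
    with k_le show ?thesis by simp
  qed
  ultimately show ?thesis using that first(1) by blast
qed

lemma iteration_bound_le_cost_ratio:
  assumes "0 < \<epsilon>" and "1 \<le> cost_ratio m n C \<gamma> \<epsilon>"
  shows "norm (4 + 44 * R_v m n C w \<gamma> / \<epsilon>) \<le> 92 * norm (cost_ratio m n C \<gamma> \<epsilon>)"
proof -
  have "R_v m n C w \<gamma> / \<epsilon> \<le> 2 * cost_ratio m n C \<gamma> \<epsilon>"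
    using divide_right_mono[OF R_v_le_max_cost, of \<epsilon>] \<open>0 < \<epsilon>\<close> by (simp add: cost_ratio_def)
  moreover have "0 \<le> R_v m n C w \<gamma> / \<epsilon>" using R_v_nonneg \<open>0 < \<epsilon>\<close> by simp
  ultimately show ?thesis using assms(2) by simp
qed

end

lemma iteration_bound_bigo:
  "(\<lambda>(m, n, p, C, w, \<gamma>, \<epsilon>). 4 + 44 * R_v m n C w \<gamma> / \<epsilon>)
     \<in> O[large_cost_ratio](\<lambda>(m, n, p, C, w, \<gamma>, \<epsilon>). cost_ratio m n C \<gamma> \<epsilon>)"
proof (rule bigoI[where c = 92])
  have "norm (4 + 44 * R_v m n C w \<gamma> / \<epsilon>) \<le> 92 * norm (cost_ratio m n C \<gamma> \<epsilon>)"
    if "barycenter_data m n p C w \<gamma>" "0 < \<epsilon>" "1 \<le> cost_ratio m n C \<gamma> \<epsilon>" for m n p C w \<gamma> \<epsilon>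
    using barycenter_problem.intro[OF that(1)] that(2,3)
    by (rule barycenter_problem.iteration_bound_le_cost_ratio)
  then show "\<forall>\<^sub>F x in large_cost_ratio.
      norm (case x of (m, n, p, C, w, \<gamma>, \<epsilon>) \<Rightarrow> 4 + 44 * R_v m n C w \<gamma> / \<epsilon>)
        \<le> 92 * norm (case x of (m, n, p, C, w, \<gamma>, \<epsilon>) \<Rightarrow> cost_ratio m n C \<gamma> \<epsilon>)"
    unfolding large_cost_ratio_def eventually_inf_principal eventually_filtercomap
    by (intro exI[of _ "\<lambda>x. 1 \<le> x"] conjI eventually_ge_at_top) auto
qed

theorem theorem1:
  fixes m n :: nat
    and p :: "nat \<Rightarrow> nat \<Rightarrow> real"
    and C :: "nat \<Rightarrow> nat \<Rightarrow> nat \<Rightarrow> real"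
    and w :: "nat \<Rightarrow> real"
    and \<gamma> \<epsilon> :: real
  assumes "barycenter_data m n p C w \<gamma>"
    and "0 < \<epsilon>"
  shows "(\<exists>N. dibp_stops_after m n p C w \<gamma> \<epsilon> N \<and>
            real N \<le> 4 + 44 * R_v m n C w \<gamma> / \<epsilon> \<and>
            (let B = dibp_plan m n p C w \<gamma> N;
                 q = mean_marginal m n w B
             in (\<Sum>l<m. w l * l1_norm n (\<lambda>j. mat_vec n (mat_transpose (B l)) ones j - q j)) \<le> \<epsilon> \<and>
                (\<forall>\<pi>. barycenter_solution m n p C w \<gamma> \<pi> \<longrightarrow>
                   objective m n C w \<gamma> B - objective m n C w \<gamma> \<pi>
                     \<le> (MAX l\<in>{..<m}. max_entry n (C l)) * \<epsilon>)))
       \<and> (\<lambda>(m, n, p, C, w, \<gamma>, \<epsilon>). 4 + 44 * R_v m n C w \<gamma> / \<epsilon>)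
           \<in> O[large_cost_ratio](\<lambda>(m, n, p, C, w, \<gamma>, \<epsilon>). cost_ratio m n C \<gamma> \<epsilon>)"
proof -
  interpret barycenter_problem m n p C w \<gamma> by (rule barycenter_problem.intro) (rule assms(1))
  obtain k where stop: "dispersion (potential k) \<le> \<epsilon>"
    and N: "dibp_stops_after m n p C w \<gamma> \<epsilon> (2 * Suc k)"
      "real (2 * Suc k) \<le> 4 + 44 * R_v m n C w \<gamma> / \<epsilon>"
    using dibp_stops[OF assms(2)] by blast
  have gap: "marginal_gap m n w (dibp_plan m n p C w \<gamma> (2 * Suc k)) \<le> \<epsilon>"
    using stop by (simp only: marginal_gap_dibp_plan)
  have objective: "objective m n C w \<gamma> (dibp_plan m n p C w \<gamma> (2 * Suc k)) - objective m n C w \<gamma> \<pi>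
      \<le> (MAX l\<in>{..<m}. max_entry n (C l)) * \<epsilon>" if "barycenter_solution m n p C w \<gamma> \<pi>" for \<pi>
    using that stop by (rule objective_dibp_plan_diff_le)
  show ?thesis
    unfolding Let_def marginal_gap_def[symmetric]
    by (intro conjI exI[of _ "2 * Suc k"] allI impI N gap objective iteration_bound_bigo)
qed

end
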